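(* Let $X$ be a finite set with at least three elements and let $\mathcal{P}$ be an $(m,k)$-partition of $X$ having exactly $m_i$ blocks of size $n_i$ for each $i\in I_k$, where $n_1<n_2<\cdots<n_k$ and $m=m_1+\cdots+m_k$. Then \[|\Gamma(X,\mathcal{P})|=\prod_{i=1}^k\Big(\sum_{j=1}^i m_j\,(n_j!)\,S(n_i,n_j)\Big)^{m_i}.\]
   Context: $I_k=\{1,\dots,k\}$. A partition of $X$ is a collection of nonempty pairwise disjoint subsets (blocks) with union $X$. For positive integers $m\ge k$, an $(m,k)$-partition is a partition with exactly $m$ blocks whose blocks have exactly $k$ distinct sizes. $\Gamma(X,\mathcal{P})$ is the set of all maps $f\colon X\to X$ such that for every block $X_i\in\mathcal{P}$ there is a block $X_j\in\mathcal{P}$ with $X_if=X_j$, where $X_if$ denotes the image of $X_i$ under $f$. $S(a,b)$ denotes the Stirling number of the second kind, the number of partitions of an $a$-element set into $b$ blocks. *)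

theory Defs
  imports
    "HOL-Library.FuncSet"
    "HOL-Library.Disjoint_Sets"
    "HOL-Combinatorics.Stirling"
begin

text \<open>Intended for finite \<open>X\<close>: \<open>card\<close> sends every infinite block to \<open>0\<close>.\<close>

definition mk_partition :: "nat \<Rightarrow> nat \<Rightarrow> 'a set \<Rightarrow> 'a set set \<Rightarrow> bool" where
  "mk_partition m k X \<P> \<longleftrightarrow>
     0 < k \<and> k \<le> m \<and> partition_on X \<P> \<and> card \<P> = m \<and> card (card ` \<P>) = k"

text \<open>Maps \<open>X \<rightarrow> X\<close> are represented by functions that are \<open>undefined\<close> outside \<open>X\<close>,
  so that each map is counted once.\<close>

definition Gamma :: "'a set \<Rightarrow> 'a set set \<Rightarrow> ('a \<Rightarrow> 'a) set" where
  "Gamma X \<P> = {f \<in> X \<rightarrow>\<^sub>E X. \<forall>A\<in>\<P>. \<exists>B\<in>\<P>. f ` A = B}"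

text \<open>The library introduces \<^const>\<open>Stirling\<close> by its recurrence; the following confirms that it
  counts set partitions.\<close>

lemma card_partitions_eq_Stirling:
  assumes "finite A"
  shows "card {\<P>. partition_on A \<P> \<and> card \<P> = b} = Stirling (card A) b"
  using assms
proof (induction A arbitrary: b rule: finite_induct)
  case empty
  have *: "{\<P>::'a set set. partition_on {} \<P> \<and> card \<P> = b} = (if b = 0 then {{}} else {})"
    by (auto simp: partition_on_empty)
  show ?case unfolding * by (cases b) simp_all
next
  case (insert a A)
  define Parts :: "nat \<Rightarrow> 'a set set set"
    where "Parts b = {\<P>. partition_on A \<P> \<and> card \<P> = b}" for b
  have fin_parts: "finite \<P>" if "\<P> \<in> Parts b" for \<P> b
    using that insert.hyps(1) finite_elements unfolding Parts_def by blast
  have fin: "finite (Parts b)" for b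
    using finitely_many_partition_on[OF insert.hyps(1)] unfolding Parts_def
    by (rule rev_finite_subset) auto
  have a_notin: "a \<notin> B" if "\<P> \<in> Parts b" "B \<in> \<P>" for \<P> B b
    using that insert.hyps(2) unfolding Parts_def partition_on_def by auto
  show ?case
  proof (cases b)
    case 0
    have "\<not> (partition_on (insert a A) \<P> \<and> card \<P> = 0)" for \<P>
    proof
      assume *: "partition_on (insert a A) \<P> \<and> card \<P> = 0"
      then have "finite \<P>" using insert.hyps(1) finite_elements by blast
      with * show False by (auto simp: partition_on_def)
    qed
    then have none: "{\<P>. partition_on (insert a A) \<P> \<and> card \<P> = b} = {}" using 0 by blast
    show ?thesis unfolding none using 0 insert.hyps by simp
  next
    case (Suc c)
    define ins where "ins = (\<lambda>(\<P>, B). insert (insert a B) (\<P> - {B}))"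
    let ?S1 = "insert {a} ` Parts c"
    let ?S2 = "ins ` (SIGMA \<P>:Parts (Suc c). \<P>)"
    have S1: "?S1 = {\<P>. partition_on (insert a A) \<P> \<and> card \<P> = Suc c \<and> {a} \<in> \<P>}"
      (is "_ = ?T1")
    proof
      show "?S1 \<subseteq> ?T1"
      proof
        fix R assume "R \<in> ?S1"
        then obtain Q where Q: "Q \<in> Parts c" "R = insert {a} Q" by auto
        have "{a} \<notin> Q" using a_notin[OF Q(1)] by auto
        moreover have "partition_on (insert a A) (insert {a} Q)"
          using Q(1) insert.hyps(2) unfolding Parts_def partition_on_def disjoint_def by auto
        ultimately show "R \<in> ?T1"
          using Q fin_parts[OF Q(1)] by (auto simp: Parts_def)
      qed
      show "?T1 \<subseteq> ?S1"
      proof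
        fix R assume R: "R \<in> ?T1"
        then have finR: "finite R" using insert.hyps(1) finite_elements by blast
        have "\<Union>(R - {{a}}) = A"
        proof -
          have ne: "x \<noteq> a" if "x \<in> B" "B \<in> R" "B \<noteq> {a}" for x B
          proof -
            have "disjoint R" "{a} \<in> R" using R by (auto simp: partition_on_def)
            then have "B \<inter> {a} = {}" using disjointD that(2,3) by metis
            then show ?thesis using that(1) by auto
          qed
          have "a \<notin> \<Union>(R - {{a}})" using ne by auto
          moreover have "\<Union>R = insert a (\<Union>(R - {{a}}))" using R by auto
          moreover have "\<Union>R = insert a A" using R by (simp add: partition_on_def)
          ultimately show ?thesis using insert.hyps(2) by (metis insert_ident)
        qed
        then have "partition_on A (R - {{a}})"
          using R unfolding partition_on_def disjoint_def by auto
        moreover have "card (R - {{a}}) = c" using R finR by simp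
        ultimately have "R - {{a}} \<in> Parts c" by (simp add: Parts_def)
        moreover have "R = insert {a} (R - {{a}})" using R by auto
        ultimately show "R \<in> ?S1" by blast
      qed
    qed
    have S2: "?S2 = {\<P>. partition_on (insert a A) \<P> \<and> card \<P> = Suc c \<and> {a} \<notin> \<P>}"
      (is "_ = ?T2")
    proof
      show "?S2 \<subseteq> ?T2"
      proof
        fix R assume "R \<in> ?S2"
        then obtain Q B where Q: "Q \<in> Parts (Suc c)" "B \<in> Q"
          and R: "R = insert (insert a B) (Q - {B})" by (auto simp: ins_def)
        have pQ: "\<Union>Q = A" "disjoint Q" "{} \<notin> Q" "card Q = Suc c"
          using Q(1) by (auto simp: Parts_def partition_on_def)
        have new: "insert a B \<notin> Q" "{a} \<notin> Q" "a \<notin> B" "B \<noteq> {}"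
          using a_notin[OF Q(1)] Q(2) pQ(3) by auto
        have "\<Union>R = insert a A" using R pQ(1) Q(2) by auto
        moreover have "disjoint R"
        proof -
          have dj: "insert a B \<inter> D = {}" if "D \<in> Q - {B}" for D
            using that disjointD[OF pQ(2) Q(2), of D] a_notin[OF Q(1), of D] by auto
          have "disjoint (Q - {B})" using pQ(2) by (auto simp: disjoint_def)
          then show ?thesis using dj unfolding R disjoint_def by (auto simp: Int_commute)
        qed
        moreover have "{} \<notin> R" using R pQ(3) by auto
        moreover have "card R = Suc c"
          using R new pQ(4) Q(2) fin_parts[OF Q(1)] by simp
        moreover have "{a} \<notin> R" using R new by auto
        ultimately show "R \<in> ?T2" by (simp add: partition_on_def)
      qed
      show "?T2 \<subseteq> ?S2"
      proof
        fix R assume R: "R \<in> ?T2"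
        then have finR: "finite R" using insert.hyps(1) finite_elements by blast
        have pR: "\<Union>R = insert a A" "disjoint R" "{} \<notin> R" "card R = Suc c" "{a} \<notin> R"
          using R by (auto simp: partition_on_def)
        obtain C where C: "C \<in> R" "a \<in> C" using pR(1) by blast
        define B where "B = C - {a}"
        define Q where "Q = insert B (R - {C})"
        have "C \<noteq> {a}" using C(1) pR(5) by blast
        then have B: "B \<noteq> {}" "insert a B = C" unfolding B_def using C(2) by blast+
        have dj: "D \<inter> C = {}" if "D \<in> R - {C}" for D
          using that disjointD[OF pR(2) _ C(1), of D] by auto
        have BR: "B \<notin> R - {C}" using dj[of B] B by (auto simp: B_def)
        have UC: "\<Union>R = C \<union> \<Union>(R - {C})" using C(1) by auto
        have "\<Union>Q = A"
        proof -
          have "a \<notin> \<Union>(R - {C})" using dj C(2) by blast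
          then show ?thesis using UC pR(1) insert.hyps(2) C(2) unfolding Q_def B_def by auto
        qed
        moreover have "disjoint Q"
        proof -
          have djB: "B \<inter> D = {}" if "D \<in> R - {C}" for D
            using dj[OF that] by (auto simp: B_def)
          have "disjoint (R - {C})" using pR(2) by (auto simp: disjoint_def)
          then show ?thesis using djB unfolding Q_def disjoint_def by (auto simp: Int_commute)
        qed
        moreover have "{} \<notin> Q" using pR(3) B(1) by (auto simp: Q_def)
        moreover have "card Q = Suc c"
          using BR finR pR(4) C(1) by (simp add: Q_def)
        ultimately have "Q \<in> Parts (Suc c)" by (simp add: Parts_def partition_on_def)
        moreover have "B \<in> Q" by (simp add: Q_def)
        moreover have "R = ins (Q, B)" using B(2) C(1) BR by (auto simp: ins_def Q_def)
        ultimately show "R \<in> ?S2" by blast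
      qed
    qed
    have inj1: "inj_on (insert {a}) (Parts c)"
    proof (rule inj_onI)
      fix Q Q' assume *: "Q \<in> Parts c" "Q' \<in> Parts c" "insert {a} Q = insert {a} Q'"
      have "{a} \<notin> Q" "{a} \<notin> Q'" using a_notin *(1,2) by blast+
      with *(3) show "Q = Q'" by (metis insert_ident)
    qed
    have inj2: "inj_on ins (SIGMA \<P>:Parts (Suc c). \<P>)"
    proof (rule inj_onI, clarify)
      fix Q B Q' B'
      assume Q: "Q \<in> Parts (Suc c)" "B \<in> Q" "Q' \<in> Parts (Suc c)" "B' \<in> Q'"
        and eq: "ins (Q, B) = ins (Q', B')"
      have "{D \<in> ins (Q, B). a \<in> D} = {insert a B}"
        using a_notin[OF Q(1)] by (auto simp: ins_def)
      moreover have "{D \<in> ins (Q', B'). a \<in> D} = {insert a B'}"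
        using a_notin[OF Q(3)] by (auto simp: ins_def)
      ultimately have "insert a B = insert a B'" using eq by simp
      then have BB: "B = B'"
        using a_notin[OF Q(1,2)] a_notin[OF Q(3,4)] by (metis insert_ident)
      have "ins (Q, B) - {insert a B} = Q - {B}" "ins (Q', B') - {insert a B'} = Q' - {B'}"
        using a_notin[OF Q(1)] a_notin[OF Q(3)] by (auto simp: ins_def)
      then have "Q - {B} = Q' - {B}" using eq BB by simp
      then have "Q = Q'" using Q BB by blast
      with BB show "Q = Q' \<and> B = B'" by simp
    qed
    have "{\<P>. partition_on (insert a A) \<P> \<and> card \<P> = b} = ?S1 \<union> ?S2"
      unfolding S1 S2 Suc by blast
    moreover have "?S1 \<inter> ?S2 = {}" unfolding S1 S2 by blast
    moreover have finS: "finite (SIGMA \<P>:Parts (Suc c). \<P>)"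
      using fin fin_parts by (intro finite_SigmaI)
    ultimately have "card {\<P>. partition_on (insert a A) \<P> \<and> card \<P> = b} = card ?S1 + card ?S2"
      using fin[of c] by (simp add: card_Un_disjoint)
    also have "card ?S1 = Stirling (card A) c"
      using card_image[OF inj1] insert.IH[of c] by (simp add: Parts_def)
    also have "card ?S2 = (\<Sum>\<P>\<in>Parts (Suc c). card \<P>)"
      using card_image[OF inj2] fin fin_parts by (simp add: card_SigmaI)
    also have "\<dots> = Suc c * Stirling (card A) (Suc c)"
      using insert.IH[of "Suc c"] by (simp add: Parts_def)
    finally show ?thesis using Suc insert.hyps by simp
  qed
qed

end

theory Submission
  imports Defs
begin

text \<open>
  A map belongs to \<^term>\<open>Gamma X \<P>\<close> iff it carries each block onto some block. This condition
  concerns the blocks of the domain one at a time, and since the blocks partition \<open>X\<close>, the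
  restrictions of a map to them may be prescribed independently. Hence the count is a product over
  the blocks \<open>A\<close> (\<open>card_maps_blockwise\<close>), and the factor of \<open>A\<close> is the number of maps from \<open>A\<close>
  onto some block. Blocks being distinct sets, a map has at most one of them as its image, so this
  factor is a sum over the target blocks \<open>B\<close> of the number of surjections from \<open>A\<close> onto \<open>B\<close>,
  namely \<open>|B|! S(|A|,|B|)\<close> (\<open>card_surjections\<close>).

  Both the factor of \<open>A\<close> and the summand of \<open>B\<close> depend on the size of the block only, so equal
  sizes can be collected into powers and multiples. In the inner sum the sizes \<open>n\<^sub>j > n\<^sub>i\<close> contribute
  nothing, as a smaller block has no surjection onto a larger one; so it stops at \<open>j = i\<close>.
\<close>

text \<open>A surjection from \<open>insert a A\<close> onto \<open>B\<close> is determined by the value \<open>b\<close> at \<open>a\<close> and by the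
  restriction to \<open>A\<close>, which is onto \<open>B\<close> or onto \<open>B - {b}\<close>. The two cases give the two terms of the
  Stirling recurrence.\<close>

lemma card_surjections:
  assumes "finite A" "finite B"
  shows "card {f \<in> A \<rightarrow>\<^sub>E B. f ` A = B} = fact (card B) * Stirling (card A) (card B)"
  using assms
proof (induction A arbitrary: B rule: finite_induct)
  case empty
  show ?case
  proof (cases "B = {}")
    case False
    then have "card B > 0" using empty by (simp add: card_gt_0_iff)
    then show ?thesis using False by (cases "card B") auto
  qed simp
next
  case (insert a A)
  define Surj where "Surj C = {f \<in> A \<rightarrow>\<^sub>E C. f ` A = C}" for C :: "'b set"
  have card_Surj: "card (Surj C) = fact (card C) * Stirling (card A) (card C)"
    if "finite C" for C
    using insert.IH[OF that] by (simp add: Surj_def)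
  have fin_Surj: "finite (Surj C)" if "finite C" for C
    unfolding Surj_def using that insert.hyps(1)
    by (intro finite_subset[OF Collect_restrict finite_PiE]) auto
  let ?ext = "\<lambda>(b, g). g(a := b)"
  let ?D = "SIGMA b:B. Surj B \<union> Surj (B - {b})"
  have "bij_betw ?ext ?D {f \<in> insert a A \<rightarrow>\<^sub>E B. f ` insert a A = B}"
  proof (rule bij_betw_byWitness[where f' = "\<lambda>f. (f a, f(a := undefined))"])
    show "\<forall>p\<in>?D. (\<lambda>f. (f a, f(a := undefined))) (?ext p) = p"
      using insert.hyps(2)
      by (auto simp: Surj_def PiE_def extensional_def fun_eq_iff)
    show "\<forall>f\<in>{f \<in> insert a A \<rightarrow>\<^sub>E B. f ` insert a A = B}. ?ext (f a, f(a := undefined)) = f"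
      by simp
    have upd: "(g(a := b)) ` A = g ` A" for g b
      using insert.hyps(2) by auto
    show "?ext ` ?D \<subseteq> {f \<in> insert a A \<rightarrow>\<^sub>E B. f ` insert a A = B}"
    proof clarify
      fix b g assume b: "b \<in> B" and g: "g \<in> Surj B \<union> Surj (B - {b})"
      then have "g \<in> A \<rightarrow>\<^sub>E B" and "insert b (g ` A) = B"
        by (auto simp: Surj_def)
      moreover have "(g(a := b)) ` insert a A = insert b (g ` A)"
        using upd[of g b] by (simp only: image_insert fun_upd_same)
      ultimately show "g(a := b) \<in> insert a A \<rightarrow>\<^sub>E B \<and> (g(a := b)) ` insert a A = B"
        using b by (metis PiE_fun_upd)
    qed
    show "(\<lambda>f. (f a, f(a := undefined))) ` {f \<in> insert a A \<rightarrow>\<^sub>E B. f ` insert a A = B} \<subseteq> ?D"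
    proof (rule image_subsetI)
      fix f assume "f \<in> {f \<in> insert a A \<rightarrow>\<^sub>E B. f ` insert a A = B}"
      then have f: "f \<in> insert a A \<rightarrow>\<^sub>E B" and im: "insert (f a) (f ` A) = B"
        by simp_all
      let ?g = "f(a := undefined)"
      have "?g \<in> A \<rightarrow>\<^sub>E f ` A"
        using f insert.hyps(2) by (auto simp: PiE_def extensional_def)
      then have "?g \<in> Surj (f ` A)"
        using upd unfolding Surj_def by (simp only: mem_Collect_eq simp_thms)
      moreover have "f ` A = B \<or> f ` A = B - {f a}" using im by blast
      ultimately have "?g \<in> Surj B \<union> Surj (B - {f a})" by (metis UnI1 UnI2)
      moreover have "f a \<in> B" using im by blast
      ultimately show "(f a, ?g) \<in> ?D" by (simp only: mem_Sigma_iff simp_thms)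
    qed
  qed
  then have "card {f \<in> insert a A \<rightarrow>\<^sub>E B. f ` insert a A = B} = card ?D"
    by (simp add: bij_betw_same_card)
  also have "\<dots> = (\<Sum>b\<in>B. card (Surj B \<union> Surj (B - {b})))"
    using insert.prems fin_Surj by (intro card_SigmaI) auto
  also have "\<dots> = (\<Sum>b\<in>B. card (Surj B) + card (Surj (B - {b})))"
    using insert.prems fin_Surj
    by (intro sum.cong refl card_Un_disjoint) (auto simp: Surj_def)
  also have "\<dots> = (\<Sum>b\<in>B. fact (card B) * Stirling (card A) (card B)
      + fact (card B - 1) * Stirling (card A) (card B - 1))"
    using insert.prems by (intro sum.cong refl) (simp add: card_Surj)
  also have "\<dots> = fact (card B) * Stirling (card (insert a A)) (card B)"
    using insert.hyps by (cases "card B") (simp_all add: algebra_simps)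
  finally show ?case .
qed

text \<open>A map on a partitioned set is the same as a family of maps on the blocks: the inverse of
  restriction evaluates at \<open>x\<close> the member of the family that belongs to the block of \<open>x\<close>.\<close>

lemma card_maps_blockwise:
  assumes P: "partition_on X \<P>" and fin: "finite X"
    and F: "\<And>A. A \<in> \<P> \<Longrightarrow> F A \<subseteq> A \<rightarrow>\<^sub>E Y"
  shows "card {f \<in> X \<rightarrow>\<^sub>E Y. \<forall>A\<in>\<P>. restrict f A \<in> F A} = (\<Prod>A\<in>\<P>. card (F A))"
proof -
  define block where "block x = (THE A. A \<in> \<P> \<and> x \<in> A)" for x
  have block_eq: "block x = A" if "A \<in> \<P>" "x \<in> A" for x A
    unfolding block_def using that partition_onD2[OF P]
    by (intro the_equality) (auto dest: disjointD)
  have X: "\<Union>\<P> = X" using P by (simp add: partition_on_def)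
  let ?split = "\<lambda>f. \<lambda>A\<in>\<P>. restrict f A"
  let ?glue = "\<lambda>h. \<lambda>x\<in>X. h (block x) x"
  have restrict_glue: "restrict (?glue h) A = h A" if "h \<in> Pi\<^sub>E \<P> F" "A \<in> \<P>" for h A
  proof
    fix x
    have "h A \<in> A \<rightarrow>\<^sub>E Y" using that F by (blast dest: PiE_mem)
    then have "h A x = undefined" if "x \<notin> A" using that by (rule PiE_arb)
    then show "restrict (?glue h) A x = h A x"
      using that(2) X block_eq by auto
  qed
  have "bij_betw ?split {f \<in> X \<rightarrow>\<^sub>E Y. \<forall>A\<in>\<P>. restrict f A \<in> F A} (Pi\<^sub>E \<P> F)"
  proof (rule bij_betw_byWitness[where f' = ?glue])
    show "\<forall>f\<in>{f \<in> X \<rightarrow>\<^sub>E Y. \<forall>A\<in>\<P>. restrict f A \<in> F A}. ?glue (?split f) = f"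
    proof clarify
      fix f assume "f \<in> X \<rightarrow>\<^sub>E Y"
      then show "?glue (?split f) = f"
        using X block_eq by (auto simp: fun_eq_iff PiE_def extensional_def)
    qed
    show "\<forall>h\<in>Pi\<^sub>E \<P> F. ?split (?glue h) = h"
    proof
      fix h assume h: "h \<in> Pi\<^sub>E \<P> F"
      show "?split (?glue h) = h"
      proof
        fix A show "?split (?glue h) A = h A"
          using h restrict_glue[OF h] by (cases "A \<in> \<P>") (auto simp: PiE_def extensional_def)
      qed
    qed
    show "?split ` {f \<in> X \<rightarrow>\<^sub>E Y. \<forall>A\<in>\<P>. restrict f A \<in> F A} \<subseteq> Pi\<^sub>E \<P> F"
      by auto
    show "?glue ` Pi\<^sub>E \<P> F \<subseteq> {f \<in> X \<rightarrow>\<^sub>E Y. \<forall>A\<in>\<P>. restrict f A \<in> F A}"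
    proof clarify
      fix h assume h: "h \<in> Pi\<^sub>E \<P> F"
      have "h (block x) x \<in> Y" if "x \<in> X" for x
      proof -
        obtain A where A: "A \<in> \<P>" "x \<in> A" using \<open>x \<in> X\<close> X by blast
        then have "h A \<in> A \<rightarrow>\<^sub>E Y" using h F by (blast dest: PiE_mem)
        then show ?thesis using A block_eq by auto
      qed
      moreover have "\<forall>A\<in>\<P>. restrict (?glue h) A \<in> F A"
        using h restrict_glue[OF h] by (auto simp: PiE_iff)
      ultimately show "?glue h \<in> X \<rightarrow>\<^sub>E Y \<and> (\<forall>A\<in>\<P>. restrict (?glue h) A \<in> F A)"
        by auto
    qed
  qed
  then show ?thesis
    using finite_elements[OF fin P] by (simp add: bij_betw_same_card card_PiE)
qed

text \<open>Each block \<open>A\<close> may be mapped onto any block \<open>B\<close>; different targets are different images, so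
  the surjections are counted without repetition.\<close>

lemma card_Gamma:
  assumes fin: "finite X" and P: "partition_on X \<P>"
  shows "card (Gamma X \<P>)
    = (\<Prod>A\<in>\<P>. \<Sum>B\<in>\<P>. fact (card B) * Stirling (card A) (card B))"
proof -
  have sub: "B \<subseteq> X" if "B \<in> \<P>" for B
    using that P by (auto simp: partition_on_def)
  have finB: "finite B" if "B \<in> \<P>" for B
    using finite_subset[OF sub[OF that] fin] .
  let ?F = "\<lambda>A. {f \<in> A \<rightarrow>\<^sub>E X. f ` A \<in> \<P>}"
  have "Gamma X \<P> = {f \<in> X \<rightarrow>\<^sub>E X. \<forall>A\<in>\<P>. restrict f A \<in> ?F A}"
    using sub by (fastforce simp: Gamma_def)
  then have "card (Gamma X \<P>) = (\<Prod>A\<in>\<P>. card (?F A))"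
    using card_maps_blockwise[OF P fin, of ?F X] by auto
  also have "\<dots> = (\<Prod>A\<in>\<P>. \<Sum>B\<in>\<P>. fact (card B) * Stirling (card A) (card B))"
  proof (rule prod.cong[OF refl])
    fix A assume A: "A \<in> \<P>"
    let ?Surj = "\<lambda>B. {f \<in> A \<rightarrow>\<^sub>E B. f ` A = B}"
    have "?F A = (\<Union>B\<in>\<P>. ?Surj B)"
      using sub by (fastforce simp: PiE_iff)
    moreover have "card (\<Union>B\<in>\<P>. ?Surj B) = (\<Sum>B\<in>\<P>. card (?Surj B))"
    proof (rule card_UN_disjoint)
      show "finite \<P>" using finite_elements[OF fin P] .
      show "\<forall>B\<in>\<P>. finite (?Surj B)"
        using finB A by (auto intro!: finite_subset[OF Collect_restrict finite_PiE])
    qed auto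
    ultimately show "card (?F A) = (\<Sum>B\<in>\<P>. fact (card B) * Stirling (card A) (card B))"
      using finB A by (simp add: card_surjections)
  qed
  finally show ?thesis .
qed

theorem theorem6p4:
  fixes X :: "'a set" and \<P> :: "'a set set"
    and m k :: nat and ms ns :: "nat \<Rightarrow> nat"
  assumes "finite X" and "card X \<ge> 3"
    and "mk_partition m k X \<P>"
    and "strict_mono_on {1..k} ns"
    and "\<And>i. i \<in> {1..k} \<Longrightarrow> card {B \<in> \<P>. card B = ns i} = ms i"
    and "m = (\<Sum>i=1..k. ms i)"
  shows "card (Gamma X \<P>)
    = (\<Prod>i=1..k. (\<Sum>j=1..i. ms j * fact (ns j) * Stirling (ns i) (ns j)) ^ ms i)"
proof -
  let ?cls = "\<lambda>i. {B \<in> \<P>. card B = ns i}"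
  have P: "partition_on X \<P>" and cardP: "card \<P> = m"
    using assms(3) by (auto simp: mk_partition_def)
  have finP: "finite \<P>" using finite_elements[OF assms(1) P] .
  have inj: "inj_on ns {1..k}"
    using assms(4) by (rule strict_mono_on_imp_inj_on)
  have dj: "\<forall>i\<in>{1..k}. \<forall>j\<in>{1..k}. i \<noteq> j \<longrightarrow> ?cls i \<inter> ?cls j = {}"
  proof (intro ballI impI)
    fix i j assume "i \<in> {1..k}" "j \<in> {1..k}" "i \<noteq> j"
    then have "ns i \<noteq> ns j" using inj_onD[OF inj] by blast
    then show "?cls i \<inter> ?cls j = {}" by auto
  qed
  have fin_cls: "\<forall>i\<in>{1..k}. finite (?cls i)"
    using finP by auto
  \<comment> \<open>The multiplicities add up to the number of blocks, so no block has a size other than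
    the \<open>ns i\<close>.\<close>
  have UN: "(\<Union>i\<in>{1..k}. ?cls i) = \<P>"
  proof (rule card_subset_eq[OF finP])
    show "card (\<Union>i\<in>{1..k}. ?cls i) = card \<P>"
      using card_UN_disjoint[OF _ fin_cls dj] assms(5,6) cardP by simp
  qed auto
  have sum_size: "(\<Sum>B\<in>\<P>. g (card B)) = (\<Sum>j=1..k. ms j * g (ns j))" for g :: "nat \<Rightarrow> nat"
    using sum.UNION_disjoint[OF _ fin_cls dj, of "\<lambda>B. g (card B)"] assms(5) unfolding UN by simp
  have prod_size: "(\<Prod>B\<in>\<P>. g (card B)) = (\<Prod>i=1..k. g (ns i) ^ ms i)" for g :: "nat \<Rightarrow> nat"
    using prod.UNION_disjoint[OF _ fin_cls dj, of "\<lambda>B. g (card B)"] assms(5) unfolding UN by simp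
  have "card (Gamma X \<P>)
      = (\<Prod>A\<in>\<P>. \<Sum>j=1..k. ms j * (fact (ns j) * Stirling (card A) (ns j)))"
    unfolding card_Gamma[OF assms(1) P] by (intro prod.cong refl sum_size)
  also have "\<dots> = (\<Prod>i=1..k. (\<Sum>j=1..k. ms j * (fact (ns j) * Stirling (ns i) (ns j))) ^ ms i)"
    by (rule prod_size)
  also have "\<dots> = (\<Prod>i=1..k. (\<Sum>j=1..i. ms j * fact (ns j) * Stirling (ns i) (ns j)) ^ ms i)"
  proof (intro prod.cong refl arg_cong[where f = "\<lambda>s. s ^ _"])
    fix i assume i: "i \<in> {1..k}"
    have "Stirling (ns i) (ns j) = 0" if "j \<in> {1..k} - {1..i}" for j
      using that i by (intro Stirling_less strict_mono_onD[OF assms(4)]) auto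
    then show "(\<Sum>j=1..k. ms j * (fact (ns j) * Stirling (ns i) (ns j)))
        = (\<Sum>j=1..i. ms j * fact (ns j) * Stirling (ns i) (ns j))"
      using i by (intro sum.mono_neutral_cong_right) auto
  qed
  finally show ?thesis .
qed

end
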